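(* Let $q\ge 2$ and $k\ge 1$ be integers, and let $F:A^{\mathbb{Z}^d}\to A^{\mathbb{Z}^d}$ be a cellular automaton. Define $\varphi_F:A\to A$ by $F(\underline{a})=\underline{\varphi_F(a)}$ for $a\in A$, where $\underline{a}\in A^{\mathbb{Z}^d}$ denotes the constant configuration with value $a$. Let $m_1,\dots,m_r$ be the cycle lengths of $\varphi_F$, and set $g_F:=\gcd(m_1,\dots,m_r)$. If there exists a continuous map $\pi:A^{\mathbb{Z}^d}\to(\mathbb{Z}/q\mathbb{Z})^{\mathbb{Z}^k}$ with $\pi\circ F=C_q^{(k)}\circ\pi$, then $q\mid g_F$.
   Context: A cellular automaton $F:A^{\mathbb{Z}^d}\to A^{\mathbb{Z}^d}$ ($d\ge 1$, $A$ a finite nonempty alphabet) is a map that is continuous for the product topology (with $A$ discrete) and commutes with all spatial shifts of $\mathbb{Z}^d$. Since $F$ commutes with shifts, it maps constant configurations to constant configurations, so $\varphi_F$ is well defined. The cycle lengths of the self-map $\varphi_F$ of the finite set $A$ are the lengths of the periodic orbits (cycles) of $\varphi_F$, i.e. the least periods of its periodic points. For integers $q\ge 2$ and $k\ge 1$, the radius-zero $q$-clock automaton $C_q^{(k)}:(\mathbb{Z}/q\mathbb{Z})^{\mathbb{Z}^k}\to(\mathbb{Z}/q\mathbb{Z})^{\mathbb{Z}^k}$ is defined by $(C_q^{(k)}(x))_v=x_v+1 \pmod q$ for all $v\in\mathbb{Z}^k$. The space $(\mathbb{Z}/q\mathbb{Z})^{\mathbb{Z}^k}$ carries the product topology of discrete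 spaces. The map $\pi$ is not required to commute with spatial shifts, nor to be surjective. *)

theory Defs
  imports "HOL-Analysis.Analysis" "HOL-Combinatorics.Combinatorics"
begin

text \<open>
  A configuration over the lattice \<open>\<int>\<^sup>d\<close> is a function on \<open>int ^ 'd\<close>, where \<open>d = CARD('d) \<ge> 1\<close>.
  The alphabet is an explicit carrier set, so that \<open>\<int>/q\<int>\<close> can be used for varying \<open>q\<close>.
  Configurations with values in \<open>A\<close> form the \<^const>\<open>topspace\<close> of the following topology.
\<close>

definition configs :: "'a set \<Rightarrow> (int ^ 'd \<Rightarrow> 'a) topology" where
  "configs A = product_topology (\<lambda>_. discrete_topology A) UNIV"

definition shift :: "int ^ 'd \<Rightarrow> (int ^ 'd \<Rightarrow> 'a) \<Rightarrow> (int ^ 'd \<Rightarrow> 'a)" where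
  "shift u x = (\<lambda>v. x (v + u))"

definition cellular_automaton ::
    "'a set \<Rightarrow> ((int ^ 'd \<Rightarrow> 'a) \<Rightarrow> (int ^ 'd \<Rightarrow> 'a)) \<Rightarrow> bool" where
  "cellular_automaton A F \<longleftrightarrow>
     continuous_map (configs A) (configs A) F \<and>
     (\<forall>u. \<forall>x \<in> topspace (configs A). F (shift u x) = shift u (F x))"

definition const_config :: "'a \<Rightarrow> int ^ 'd \<Rightarrow> 'a" where
  "const_config a = (\<lambda>_. a)"

definition const_map :: "((int ^ 'd \<Rightarrow> 'a) \<Rightarrow> (int ^ 'd \<Rightarrow> 'a)) \<Rightarrow> 'a \<Rightarrow> 'a" where
  "const_map F a = (THE b. F (const_config a) = const_config b)"

text \<open>
  \<^const>\<open>least_power\<close> is the least positive return time; it is only meaningful at periodic points,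
  hence the explicit restriction to points that do return.
\<close>

definition cycle_lengths :: "'a set \<Rightarrow> ('a \<Rightarrow> 'a) \<Rightarrow> nat set" where
  "cycle_lengths A f = {least_power f a |a. a \<in> A \<and> (\<exists>n>0. (f ^^ n) a = a)}"

text \<open>\<open>\<int>/q\<int>\<close> is represented by the canonical residues \<open>{..<q}\<close>.\<close>

definition clock :: "nat \<Rightarrow> (int ^ 'k \<Rightarrow> nat) \<Rightarrow> (int ^ 'k \<Rightarrow> nat)" where
  "clock q x = (\<lambda>v. (x v + 1) mod q)"

lemma topspace_configs: "x \<in> topspace (configs A) \<longleftrightarrow> (\<forall>v. x v \<in> A)"
  by (auto simp: configs_def PiE_iff)

lemma const_map:
  assumes "cellular_automaton A F" "a \<in> A"
  shows "F (const_config a) = const_config (const_map F a)" "const_map F a \<in> A"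
proof -
  let ?c = "const_config a"
  have c: "?c \<in> topspace (configs A)"
    using assms(2) by (simp add: topspace_configs const_config_def)
  have sh: "shift u ?c = ?c" for u
    by (simp add: shift_def const_config_def)
  have "F ?c u = F ?c 0" for u
  proof -
    have "F ?c = shift u (F ?c)"
      using assms(1) c sh[of u] unfolding cellular_automaton_def by metis
    from fun_cong[OF this, of 0] show ?thesis
      by (simp add: shift_def)
  qed
  then have eq: "F ?c = const_config (F ?c 0)"
    by (auto simp: const_config_def)
  have m: "const_map F a = F ?c 0"
    unfolding const_map_def
  proof (rule the_equality)
    show "b = F ?c 0" if "F ?c = const_config b" for b
      using that by (simp add: const_config_def)
  qed (rule eq)
  then show "F (const_config a) = const_config (const_map F a)"
    using eq by simp
  have "F ?c \<in> topspace (configs A)"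
    using assms(1) c unfolding cellular_automaton_def continuous_map_def by blast
  then show "const_map F a \<in> A"
    by (simp add: m topspace_configs)
qed

end

theory Submission
  imports Defs
begin

text \<open>
  A semiconjugacy to the clock forces return times to be multiples of \<open>q\<close>: if \<open>x\<close> returns to itself
  after \<open>n\<close> steps, then so does \<open>\<pi> x\<close>, but after \<open>n\<close> steps every cell of the clock has advanced by
  \<open>n\<close> modulo \<open>q\<close>. A point \<open>a\<close> on a cycle of \<^term>\<open>const_map F\<close> of length \<open>m\<close> is, read as the constant
  configuration, such a point \<open>x\<close> with \<open>n = m\<close>. So \<open>q\<close> divides every cycle length, and hence their
  greatest common divisor. The advance modulo \<open>q\<close> is read off in a single cell of the clock.
\<close>

lemma funpow_const_config:
  assumes "cellular_automaton A F" "a \<in> A"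
  shows "(F ^^ n) (const_config a) = const_config ((const_map F ^^ n) a)
    \<and> (const_map F ^^ n) a \<in> A"
  by (induction n) (use assms const_map in auto)

lemma clock_semiconjugacy_funpow:
  assumes S: "\<And>x. x \<in> S \<Longrightarrow> F x \<in> S"
    and val: "\<And>x. x \<in> S \<Longrightarrow> \<pi> x v < q"
    and conj: "\<And>x. x \<in> S \<Longrightarrow> \<pi> (F x) = clock q (\<pi> x)"
    and x: "x \<in> S"
  shows "\<pi> ((F ^^ n) x) v = (\<pi> x v + n) mod q"
proof -
  have "(F ^^ n) x \<in> S \<and> \<pi> ((F ^^ n) x) v = (\<pi> x v + n) mod q"
    by (induction n) (use x val S conj in \<open>auto simp: clock_def mod_Suc_eq\<close>)
  then show ?thesis ..
qed

text \<open>
  Over a fixed point of \<open>F ^^ n\<close>, the value of the clock in one cell returns after \<open>n\<close> increments.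
\<close>

lemma clock_dvd_return_time:
  assumes "\<And>x. x \<in> S \<Longrightarrow> F x \<in> S"
    and val: "\<And>x. x \<in> S \<Longrightarrow> \<pi> x v < q"
    and "\<And>x. x \<in> S \<Longrightarrow> \<pi> (F x) = clock q (\<pi> x)"
    and x: "x \<in> S" and ret: "(F ^^ n) x = x"
  shows "q dvd n"
proof -
  have "(\<pi> x v + n) mod q = \<pi> x v mod q"
    using clock_semiconjugacy_funpow[of S F \<pi> v q x n] assms by simp
  then have "q dvd \<pi> x v + n - \<pi> x v"
    by (subst (asm) mod_eq_dvd_iff_nat) auto
  then show ?thesis
    by simp
qed

theorem theorem1p1:
  fixes A :: "'a set"
    and F :: "(int ^ 'd \<Rightarrow> 'a) \<Rightarrow> (int ^ 'd \<Rightarrow> 'a)"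
    and q :: nat
  assumes "q \<ge> 2"
    and "finite A" and "A \<noteq> {}"
    and "cellular_automaton A F"
    and "\<exists>\<pi> :: (int ^ 'd \<Rightarrow> 'a) \<Rightarrow> (int ^ 'k \<Rightarrow> nat).
           continuous_map (configs A) (configs {..<q}) \<pi> \<and>
           (\<forall>x \<in> topspace (configs A). \<pi> (F x) = clock q (\<pi> x))"
  shows "q dvd Gcd (cycle_lengths A (const_map F))"
proof (rule Gcd_greatest)
  let ?S = "topspace (configs A) :: (int ^ 'd \<Rightarrow> 'a) set"
  obtain \<pi> :: "(int ^ 'd \<Rightarrow> 'a) \<Rightarrow> (int ^ 'k \<Rightarrow> nat)"
    where cont: "continuous_map (configs A) (configs {..<q}) \<pi>"
      and conj: "\<And>x. x \<in> ?S \<Longrightarrow> \<pi> (F x) = clock q (\<pi> x)"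
    using assms(5) by blast
  have F: "F x \<in> ?S" if "x \<in> ?S" for x
    using assms(4) that unfolding cellular_automaton_def continuous_map_def by blast
  have val: "\<pi> x v < q" if "x \<in> ?S" for x v
  proof -
    have "\<pi> x \<in> topspace (configs {..<q})"
      using cont that unfolding continuous_map_def by blast
    then show ?thesis
      by (simp add: topspace_configs)
  qed
  fix m assume "m \<in> cycle_lengths A (const_map F)"
  then obtain a where m: "m = least_power (const_map F) a" and a: "a \<in> A"
    and per: "\<exists>n>0. (const_map F ^^ n) a = a"
    by (auto simp: cycle_lengths_def)
  have "(const_map F ^^ m) a = a"
    unfolding m least_power_def using per by (metis (mono_tags, lifting) LeastI_ex)
  then have "(F ^^ m) (const_config a) = const_config a"
    using funpow_const_config[OF assms(4) a] by simp
  moreover have "const_config a \<in> ?S"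
    using a by (simp add: topspace_configs const_config_def)
  ultimately show "q dvd m"
    using clock_dvd_return_time[of ?S F \<pi> _ q] F val conj by blast
qed

end
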